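(* Let $d\ge 1$ and $f\in L_1(\mathbb{R}^d)$. Then $f\in A(\mathbb{R}^d)$ if and only if $f\in C(\mathbb{R}^d)$ and $\widehat f\in L_1(\mathbb{R}^d)$.
   Context: For $x,y\in\mathbb{R}^d$, $(x,y)=\sum_{k=1}^d x_ky_k$. The Fourier transform of $f\in L_1(\mathbb{R}^d)$ is $\widehat f(y)=\int_{\mathbb{R}^d} f(x)e^{-i(x,y)}\,dx$ (the normalization constant is irrelevant here). $C(\mathbb{R}^d)$ is the set of continuous functions on $\mathbb{R}^d$. The Wiener algebra $A(\mathbb{R}^d)$ is the set of all functions $f$ on $\mathbb{R}^d$ of the form $f(x)=\int_{\mathbb{R}^d} g(y)e^{-i(x,y)}\,dy$ for all $x\in\mathbb{R}^d$, with some $g\in L_1(\mathbb{R}^d)$; its norm is $\|f\|_A=\int_{\mathbb{R}^d}|g(y)|\,dy$. *)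

theory Defs
  imports "HOL-Analysis.Analysis"
begin

definition fourier_transform :: "(real ^ 'n \<Rightarrow> complex) \<Rightarrow> real ^ 'n \<Rightarrow> complex" where
  "fourier_transform f y =
     (LINT x|lebesgue. f x * exp (- (\<i> * complex_of_real (x \<bullet> y))))"

(* Members are functions, not almost-everywhere classes: the representation is required at every x. *)
definition wiener_algebra :: "(real ^ 'n \<Rightarrow> complex) set" where
  "wiener_algebra =
     {f. \<exists>g. integrable lebesgue g \<and>
           (\<forall>x. f x = (LINT y|lebesgue. g y * exp (- (\<i> * complex_of_real (x \<bullet> y)))))}"

end

theory Submission
  imports Defs "HOL-Probability.Characteristic_Functions"
begin

text \<open>
  Write \<open>F\<close> for the Fourier transform in dimension \<open>d\<close>. The proof inserts the weight
  \<open>exp (- |y|^2 / (2 s^2))\<close> into the integral of \<open>F (F g)\<close>. Fubini's theorem then turns it into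
  \<open>(2 \<pi>)^d\<close> times the integral of \<open>g\<close> against a Gauss kernel of mass \<open>1\<close> centred at \<open>- x\<close>
  (\<open>fourier_gauss_smoothing\<close>), while for integrable \<open>F g\<close> the weighted integral
  converges to \<open>F (F g) x\<close> as \<open>s\<close> tends to infinity (\<open>fourier_gauss_limit\<close>).

  If \<open>f\<close> is continuous and both \<open>f\<close> and \<open>F f\<close> are integrable, the kernels form an
  approximate identity (\<open>gauss_approximate_identity\<close>), so \<open>F (F f) (- x) = (2 \<pi>)^d f x\<close> holds
  at every point, and \<open>f\<close> is the transform of the reflected and scaled \<open>F f\<close>.

  Conversely let \<open>f = F g\<close> with \<open>f\<close> and \<open>g\<close> integrable. Continuity follows from dominated
  convergence. The function \<open>F f = F (F g)\<close> is a pointwise limit of reflected convolutions whose norms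
  are at most \<open>(2 \<pi>)^d\<close> times the norm of \<open>g\<close>, so Fatou's lemma shows that it is integrable
  (\<open>integrable_double_fourier\<close>), without any almost everywhere convergence theorem.

  These arguments use Borel measurable functions. A continuous \<open>f\<close> is one already, and \<open>g\<close> may be
  changed on a null set (\<open>lebesgue_integrable_borel_version\<close>).
\<close>

section \<open>Gaussian integrals\<close>

text \<open>This is the characteristic function of the standard normal distribution, freed of the
  normalisation of the density.\<close>
lemma gaussian_integral_1d:
  fixes u :: real
  shows "(LINT x|lborel. complex_of_real (exp (- x\<^sup>2 / 2)) * exp (- (\<i> * complex_of_real (x * u))))
          = complex_of_real (sqrt (2 * pi) * exp (- u\<^sup>2 / 2))"
    (is ?I)
    and "integrable lborel (\<lambda>x. complex_of_real (exp (- x\<^sup>2 / 2)) * exp (- (\<i> * complex_of_real (x * u))))"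
    (is ?J)
proof -
  let ?f = "\<lambda>x. complex_of_real (exp (- x\<^sup>2 / 2)) * exp (- (\<i> * complex_of_real (x * u)))"
  have eq: "std_normal_density x *\<^sub>R iexp (- u * x) = (1 / sqrt (2 * pi)) *\<^sub>R ?f x" for x
    by (simp add: std_normal_density_def scaleR_conv_of_real mult_ac)
  have "complex_of_real (exp (- u\<^sup>2 / 2)) = (CLINT x|std_normal_distribution. iexp (- u * x))"
    using fun_cong[OF char_std_normal_distribution, of "- u"] by (simp add: char_def)
  also have "\<dots> = (LINT x|lborel. std_normal_density x *\<^sub>R iexp (- u * x))"
    by (rule integral_density) auto
  also have "\<dots> = (1 / sqrt (2 * pi)) *\<^sub>R (LINT x|lborel. ?f x)"
    unfolding eq by simp
  finally show ?I
    by (simp add: scaleR_conv_of_real field_simps)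
  have "integrable lborel std_normal_density"
    by (rule integrable_normal_density) simp
  then have "integrable lborel (\<lambda>x. exp (- x\<^sup>2 / 2) :: real)"
    using integrable_mult_right[of "sqrt (2 * pi)" lborel std_normal_density]
    unfolding std_normal_density_def by simp
  then show ?J
    by (rule Bochner_Integration.integrable_bound) (auto simp: norm_mult)
qed

lemma has_bochner_integral_lborel_prod:
  fixes f :: "'a::euclidean_space \<Rightarrow> real \<Rightarrow> complex"
  assumes int: "\<And>b. b \<in> Basis \<Longrightarrow> integrable lborel (f b)"
  shows "has_bochner_integral lborel (\<lambda>x::'a. \<Prod>b\<in>Basis. f b (x \<bullet> b))
           (\<Prod>b\<in>Basis. (LINT t|lborel. f b t))"
proof -
  interpret product_sigma_finite "\<lambda>_::'a. lborel :: real measure" ..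
  have [measurable]: "f b \<in> borel_measurable borel" if "b \<in> Basis" for b
    using borel_measurable_integrable[OF int[OF that]] by simp
  have meas: "(\<lambda>x::'a. \<Prod>b\<in>Basis. f b (x \<bullet> b)) \<in> borel_measurable borel"
    by measurable
  have coord: "(\<Prod>b\<in>Basis. f b ((\<Sum>b'\<in>Basis. x b' *\<^sub>R b') \<bullet> b)) = (\<Prod>b\<in>Basis. f b (x b))" for x
    by (intro prod.cong) auto
  have "integrable lborel (\<lambda>x::'a. \<Prod>b\<in>Basis. f b (x \<bullet> b))"
    by (subst lborel_eq, subst integrable_distr_eq)
      (use meas in \<open>simp_all add: coord product_integrable_prod int\<close>)
  moreover have "(LINT x|lborel. (\<Prod>b\<in>Basis. f b (x \<bullet> b))) = (\<Prod>b\<in>Basis. (LINT t|lborel. f b t))"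
    by (subst lborel_eq, subst integral_distr)
      (use meas in \<open>simp_all add: coord product_integral_prod int\<close>)
  ultimately show ?thesis
    by (simp add: has_bochner_integral_iff)
qed

text \<open>The norm square and the phase are both sums over the basis, so the integrand is a product
  of one-dimensional integrands.\<close>
lemma gaussian_fourier:
  fixes u :: "'a::euclidean_space"
  shows "has_bochner_integral lborel
           (\<lambda>x. complex_of_real (exp (- (norm x)\<^sup>2 / 2)) * exp (- (\<i> * complex_of_real (x \<bullet> u))))
           (complex_of_real (sqrt (2 * pi) ^ DIM('a) * exp (- (norm u)\<^sup>2 / 2)))"
proof -
  have norm_sq: "- (norm x)\<^sup>2 / 2 = (\<Sum>b\<in>Basis. - (x \<bullet> b)\<^sup>2 / 2)" for x :: 'a
    unfolding power2_norm_eq_inner by (subst euclidean_inner)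
       (simp add: power2_eq_square sum_negf sum_divide_distrib)
  have phase: "- (\<i> * complex_of_real (x \<bullet> u)) = (\<Sum>b\<in>Basis. - (\<i> * complex_of_real ((x \<bullet> b) * (u \<bullet> b))))"
    for x by (subst euclidean_inner) (simp add: sum_negf sum_distrib_left)
  have integrand: "complex_of_real (exp (- (norm x)\<^sup>2 / 2)) * exp (- (\<i> * complex_of_real (x \<bullet> u))) =
      (\<Prod>b\<in>Basis. complex_of_real (exp (- (x \<bullet> b)\<^sup>2 / 2)) * exp (- (\<i> * complex_of_real ((x \<bullet> b) * (u \<bullet> b)))))"
    for x
    unfolding norm_sq phase by (simp only: exp_sum finite_Basis prod.distrib of_real_prod)
  have "has_bochner_integral lborel
           (\<lambda>x. complex_of_real (exp (- (norm x)\<^sup>2 / 2)) * exp (- (\<i> * complex_of_real (x \<bullet> u))))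
           (\<Prod>b\<in>(Basis::'a set). (LINT t|lborel. complex_of_real (exp (- t\<^sup>2 / 2)) * exp (- (\<i> * complex_of_real (t * (u \<bullet> b))))))"
    unfolding integrand
    by (rule has_bochner_integral_lborel_prod
        [of "\<lambda>b t. complex_of_real (exp (- t\<^sup>2 / 2)) * exp (- (\<i> * complex_of_real (t * (u \<bullet> b))))"])
       (rule gaussian_integral_1d(2))
  also have "(\<Prod>b\<in>(Basis::'a set). (LINT t|lborel. complex_of_real (exp (- t\<^sup>2 / 2)) * exp (- (\<i> * complex_of_real (t * (u \<bullet> b))))))
      = complex_of_real (sqrt (2 * pi) ^ DIM('a) * exp (- (norm u)\<^sup>2 / 2))"
    unfolding gaussian_integral_1d(1) norm_sq
    by (simp only: exp_sum finite_Basis of_real_prod[symmetric] prod.distrib prod_constant)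
  finally show ?thesis .
qed

lemma has_bochner_integral_lborel_affine:
  fixes f :: "'a::euclidean_space \<Rightarrow> 'b::{banach, second_countable_topology}"
  assumes f: "has_bochner_integral lborel f I" and c: "c \<noteq> 0"
  shows "has_bochner_integral lborel (\<lambda>x. f (t + c *\<^sub>R x)) (I /\<^sub>R \<bar>c\<bar> ^ DIM('a))"
proof -
  have [measurable]: "f \<in> borel_measurable borel"
    using f by (auto simp: has_bochner_integral_iff dest: borel_measurable_integrable)
  have "has_bochner_integral (density (distr lborel borel (\<lambda>x::'a. t + c *\<^sub>R x)) (\<lambda>_. ennreal (\<bar>c\<bar> ^ DIM('a)))) f I"
    using f lborel_affine[OF c, of t] by (simp add: ennreal_power)
  then have "integrable lborel (\<lambda>x. \<bar>c\<bar> ^ DIM('a) *\<^sub>R f (t + c *\<^sub>R x))"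
    "I = (LINT x|lborel. \<bar>c\<bar> ^ DIM('a) *\<^sub>R f (t + c *\<^sub>R x))"
    by (auto simp: has_bochner_integral_iff integrable_density integral_density
        integrable_distr_eq integral_distr)
  moreover have "integrable lborel (\<lambda>x. f (t + c *\<^sub>R x))"
    using integrable_scaleR_right[OF calculation(1), of "inverse (\<bar>c\<bar> ^ DIM('a))"] c by simp
  ultimately show ?thesis using c
    by (simp add: has_bochner_integral_iff)
qed

section \<open>The Gauss kernel\<close>

text \<open>The density of the centred normal distribution with standard deviation \<open>1/s\<close> in each
  coordinate; it concentrates at the origin as \<open>s\<close> grows.\<close>
definition gauss_kernel :: "real \<Rightarrow> 'a::euclidean_space \<Rightarrow> real" where
  "gauss_kernel s u = (s / sqrt (2 * pi)) ^ DIM('a) * exp (- (norm (s *\<^sub>R u))\<^sup>2 / 2)"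

lemma gauss_kernel_nonneg: "s \<ge> 0 \<Longrightarrow> gauss_kernel s u \<ge> 0"
  by (simp add: gauss_kernel_def)

lemma gauss_kernel_measurable [measurable]: "gauss_kernel s \<in> borel_measurable borel"
  unfolding gauss_kernel_def by measurable

lemma gauss_kernel_rescale:
  fixes u :: "'a::euclidean_space"
  assumes "s > 0"
  shows "gauss_kernel s (u /\<^sub>R s) = s ^ DIM('a) * gauss_kernel 1 u"
  using assms by (simp add: gauss_kernel_def power_divide)

text \<open>The kernel arises as the Fourier transform of the slowly decaying summability weight
  \<open>exp (- |y|^2 / (2 s^2))\<close>, which tends to \<open>1\<close> as \<open>s\<close> grows.\<close>
lemma gauss_weight_fourier:
  fixes u :: "'a::euclidean_space"
  assumes s: "s > 0"
  shows "has_bochner_integral lborel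
           (\<lambda>y. complex_of_real (exp (- (norm (y /\<^sub>R s))\<^sup>2 / 2)) * exp (- (\<i> * complex_of_real (y \<bullet> u))))
           (complex_of_real ((2 * pi) ^ DIM('a) * gauss_kernel s u))"
proof -
  define q where "q = sqrt (2 * pi)"
  have q: "q > 0" "2 * pi = q * q"
    by (auto simp: q_def)
  define E where "E = exp (- (norm (s *\<^sub>R u))\<^sup>2 / 2)"
  have "(q ^ DIM('a) * E) * s ^ DIM('a) = (2 * pi) ^ DIM('a) * gauss_kernel s u"
    using q(1) unfolding gauss_kernel_def q_def[symmetric] E_def[symmetric] unfolding q(2)
    by (simp add: power_divide power_mult_distrib)
  moreover have "inverse (\<bar>inverse s\<bar> ^ DIM('a)) = s ^ DIM('a)"
    using s by (simp add: power_inverse)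
  ultimately have val: "complex_of_real (q ^ DIM('a) * E) /\<^sub>R \<bar>inverse s\<bar> ^ DIM('a)
      = complex_of_real ((2 * pi) ^ DIM('a) * gauss_kernel s u)"
    unfolding scaleR_conv_of_real of_real_mult[symmetric] by (simp only: mult.commute)
  have phase: "(0 + inverse s *\<^sub>R y) \<bullet> (s *\<^sub>R u) = y \<bullet> u" for y
    using s by simp
  have "inverse s \<noteq> 0"
    using s by simp
  from has_bochner_integral_lborel_affine[OF gaussian_fourier[of "s *\<^sub>R u"] this, of 0]
  show ?thesis
    unfolding phase q_def[symmetric] E_def[symmetric] val by simp
qed

lemma has_bochner_integral_gauss_kernel:
  fixes a :: "'a::euclidean_space"
  assumes s: "s > 0"
  shows "has_bochner_integral lborel (\<lambda>t. gauss_kernel s (t - a)) 1"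
proof -
  have "has_bochner_integral lborel (\<lambda>x::'a. Re (complex_of_real (exp (- (norm x)\<^sup>2 / 2))))
      (Re (complex_of_real (sqrt (2 * pi) ^ DIM('a))))"
    using gaussian_fourier[of "0::'a"] by (intro has_bochner_integral_Re) simp
  then have "has_bochner_integral lborel (\<lambda>x::'a. (s / sqrt (2 * pi)) ^ DIM('a) * exp (- (norm x)\<^sup>2 / 2))
      ((s / sqrt (2 * pi)) ^ DIM('a) * sqrt (2 * pi) ^ DIM('a))"
    by (intro has_bochner_integral_mult_right) simp
  from has_bochner_integral_lborel_affine[OF this, of s "- s *\<^sub>R a"] s
  show ?thesis
    by (simp add: gauss_kernel_def power_divide scaleR_diff_right)
qed

section \<open>Gaussian summation of the double Fourier integral\<close>

text \<open>The transform is taken over the uncompleted measure because Fubini's theorem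
  needs joint measurability with respect to a product \<open>\<sigma>\<close>-algebra.\<close>
definition borel_fourier :: "('a::euclidean_space \<Rightarrow> complex) \<Rightarrow> 'a \<Rightarrow> complex" where
  "borel_fourier g y = (LINT x|lborel. g x * exp (- (\<i> * complex_of_real (x \<bullet> y))))"

lemma continuous_borel_fourier:
  fixes g :: "'a::euclidean_space \<Rightarrow> complex"
  assumes g: "integrable lborel g"
  shows "continuous_on UNIV (borel_fourier g)"
proof (rule continuous_on_sequentiallyI)
  fix u :: "nat \<Rightarrow> 'a" and a
  assume u: "u \<longlonglongrightarrow> a"
  have [measurable]: "g \<in> borel_measurable borel"
    using g by auto
  show "(\<lambda>n. borel_fourier g (u n)) \<longlonglongrightarrow> borel_fourier g a"
    unfolding borel_fourier_def
  proof (rule integral_dominated_convergence[where w="\<lambda>x. norm (g x)"])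
    show "AE x in lborel. (\<lambda>n. g x * exp (- (\<i> * complex_of_real (x \<bullet> u n))))
        \<longlonglongrightarrow> g x * exp (- (\<i> * complex_of_real (x \<bullet> a)))"
      by (intro AE_I2 tendsto_intros u)
  qed (use g in \<open>auto simp: norm_mult\<close>)
qed

lemma borel_fourier_measurable [measurable]:
  "integrable lborel g \<Longrightarrow> borel_fourier g \<in> borel_measurable borel"
  by (rule borel_measurable_continuous_onI) (rule continuous_borel_fourier)

text \<open>The identity behind both directions. Without the weight the double integral defining
  the transform of \<open>borel_fourier g\<close> does not converge absolutely; with it, Fubini's theorem
  applies, and the inner integral is the Gauss kernel. The argument \<open>t + x\<close>, rather than
  \<open>t - x\<close>, appears because both transforms carry the same sign in the exponent.\<close>
lemma fourier_gauss_smoothing: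
  fixes g :: "'a::euclidean_space \<Rightarrow> complex"
  assumes g: "integrable lborel g" and s: "s > 0"
  shows "(LINT y|lborel. borel_fourier g y * exp (- (\<i> * complex_of_real (y \<bullet> x))) *
            complex_of_real (exp (- (norm (y /\<^sub>R s))\<^sup>2 / 2)))
       = complex_of_real ((2 * pi) ^ DIM('a)) * (LINT t|lborel. g t * complex_of_real (gauss_kernel s (t + x)))"
proof -
  have [measurable]: "g \<in> borel_measurable borel"
    using g by auto
  define w where "w y = exp (- (norm (y /\<^sub>R s))\<^sup>2 / 2)" for y :: 'a
  have [measurable]: "w \<in> borel_measurable borel"
    unfolding w_def by measurable
  define H where "H t y = g t * (complex_of_real (w y) * exp (- (\<i> * complex_of_real (y \<bullet> (t + x)))))" for t y
  have Hy: "has_bochner_integral lborel (H t)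
      (g t * complex_of_real ((2 * pi) ^ DIM('a) * gauss_kernel s (t + x)))" for t
    unfolding H_def w_def by (intro has_bochner_integral_mult_right gauss_weight_fourier s)
  have normH: "norm (H t y) = norm (g t) * w y" for t y
    by (simp add: H_def norm_mult w_def)
  have [measurable]: "case_prod H \<in> borel_measurable (lborel \<Otimes>\<^sub>M lborel)"
    unfolding H_def by measurable
  have "integrable (lborel \<Otimes>\<^sub>M lborel) (case_prod H)"
    by (rule lborel_pair.Fubini_integrable)
      (use g Hy in \<open>auto simp: normH has_bochner_integral_iff\<close>)
  then have "(LINT y|lborel. LINT t|lborel. H t y) = (LINT t|lborel. LINT y|lborel. H t y)"
    by (rule lborel_pair.Fubini_integral)
  moreover have "(LINT t|lborel. H t y) = borel_fourier g y * exp (- (\<i> * complex_of_real (y \<bullet> x))) * complex_of_real (w y)" for y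
  proof -
    define C where "C = exp (- (\<i> * complex_of_real (y \<bullet> x))) * complex_of_real (w y)"
    have "H t y = g t * exp (- (\<i> * complex_of_real (t \<bullet> y))) * C" for t
      by (simp add: H_def C_def inner_add_right inner_commute distrib_left exp_add exp_diff exp_minus field_simps)
    then have "(LINT t|lborel. H t y) = borel_fourier g y * C"
      by (simp only: borel_fourier_def integral_mult_left_zero)
    then show ?thesis
      by (simp only: C_def mult.assoc)
  qed
  moreover have "(LINT y|lborel. H t y) = complex_of_real ((2 * pi) ^ DIM('a)) * (g t * complex_of_real (gauss_kernel s (t + x)))" for t
    using Hy[of t] by (simp add: has_bochner_integral_iff mult_ac)
  ultimately show ?thesis
    by (simp add: w_def)
qed

text \<open>The weights are bounded by \<open>1\<close> and tend to \<open>1\<close>, so they may be removed in the limit by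
  dominated convergence as soon as \<open>h\<close> is integrable.\<close>
lemma fourier_gauss_limit:
  fixes h :: "'a::euclidean_space \<Rightarrow> complex"
  assumes h: "integrable lborel h"
  shows "(\<lambda>n. LINT y|lborel. h y * exp (- (\<i> * complex_of_real (y \<bullet> x))) *
            complex_of_real (exp (- (norm (y /\<^sub>R real (Suc n)))\<^sup>2 / 2))) \<longlonglongrightarrow> borel_fourier h x"
  unfolding borel_fourier_def
proof (rule integral_dominated_convergence[where w="\<lambda>x. norm (h x)"])
  have [measurable]: "h \<in> borel_measurable borel"
    using h by auto
  show "(\<lambda>y. h y * exp (- (\<i> * complex_of_real (y \<bullet> x)))) \<in> borel_measurable lborel"
    "\<And>n. (\<lambda>y. h y * exp (- (\<i> * complex_of_real (y \<bullet> x))) *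
            complex_of_real (exp (- (norm (y /\<^sub>R real (Suc n)))\<^sup>2 / 2))) \<in> borel_measurable lborel"
    by measurable
  have "(\<lambda>n. y /\<^sub>R real (Suc n)) \<longlonglongrightarrow> 0 *\<^sub>R y" for y :: 'a
    by (intro tendsto_intros LIMSEQ_inverse_real_of_nat)
  then have lim: "(\<lambda>n. complex_of_real (exp (- (norm (y /\<^sub>R real (Suc n)))\<^sup>2 / 2))) \<longlonglongrightarrow>
       complex_of_real (exp (- (norm (0::'a))\<^sup>2 / 2))" for y :: 'a
    by (intro tendsto_intros) (auto simp del: of_nat_Suc)
  show "AE y in lborel. (\<lambda>n. h y * exp (- (\<i> * complex_of_real (y \<bullet> x))) *
            complex_of_real (exp (- (norm (y /\<^sub>R real (Suc n)))\<^sup>2 / 2)))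
      \<longlonglongrightarrow> h y * exp (- (\<i> * complex_of_real (y \<bullet> x)))"
    using tendsto_mult[OF tendsto_const lim] by (intro AE_I2) simp
  show "AE y in lborel. norm (h y * exp (- (\<i> * complex_of_real (y \<bullet> x))) *
            complex_of_real (exp (- (norm (y /\<^sub>R real (Suc n)))\<^sup>2 / 2))) \<le> norm (h y)" for n
    by (intro AE_I2) (auto simp: norm_mult intro!: mult_left_le)
qed (use h in auto)

text \<open>The expression is a bound for the Gauss kernel outside the ball of radius \<open>r\<close> in
  dimension \<open>d\<close>.\<close>
lemma gauss_kernel_tail:
  assumes "r > 0"
  shows "(\<lambda>n. (real (Suc n) / sqrt (2 * pi)) ^ d * exp (- (real (Suc n) * r)\<^sup>2 / 2)) \<longlonglongrightarrow> 0"
proof -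
  have "filterlim (\<lambda>n. r * real (Suc n)) at_top sequentially"
    using assms by (intro filterlim_tendsto_pos_mult_at_top[OF tendsto_const] filterlim_compose[OF filterlim_real_sequentially filterlim_Suc])
  from filterlim_compose[OF tendsto_power_div_exp_0 this, of d]
  have "(\<lambda>n. inverse (r * sqrt (2 * pi)) ^ d * exp (1/2) * ((r * real (Suc n)) ^ d / exp (r * real (Suc n)))) \<longlonglongrightarrow> 0"
    by (rule tendsto_mult_right_zero)
  then show ?thesis
  proof (rule tendsto_0_le[where K=1], intro always_eventually allI)
    fix n
    define p where "p = r * real (Suc n)"
    \<comment> \<open>Completing the square trades the Gaussian for an exponential, whose decay beats any power.\<close>
    have "- p\<^sup>2 / 2 \<le> 1/2 - p"
      using zero_le_power2[of "p - 1"] by (simp add: power2_diff)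
    then have "exp (- p\<^sup>2 / 2) \<le> exp (1/2) / exp p"
      by (simp flip: exp_diff)
    moreover define c where "c = inverse (r * sqrt (2 * pi)) ^ d"
    moreover have "c \<ge> 0" "p > 0"
      using assms by (auto simp: c_def p_def)
    ultimately have le: "c * p ^ d * exp (- p\<^sup>2 / 2) \<le> c * p ^ d * (exp (1/2) / exp p)"
      by (intro mult_left_mono) auto
    have "(real (Suc n) / sqrt (2 * pi)) ^ d = c * p ^ d"
    proof -
      have "real (Suc n) / sqrt (2 * pi) = inverse (r * sqrt (2 * pi)) * p"
        using assms by (simp add: p_def field_simps)
      then show ?thesis
        by (simp only: c_def power_mult_distrib)
    qed
    moreover have "(real (Suc n) * r)\<^sup>2 = p\<^sup>2"
      by (simp add: p_def mult.commute)
    moreover have "0 \<le> c * p ^ d * exp (- p\<^sup>2 / 2)"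
      using \<open>c \<ge> 0\<close> \<open>p > 0\<close> by simp
    ultimately show "norm ((real (Suc n) / sqrt (2 * pi)) ^ d * exp (- (real (Suc n) * r)\<^sup>2 / 2)) \<le>
       norm (inverse (r * sqrt (2 * pi)) ^ d * exp (1/2) * ((r * real (Suc n)) ^ d / exp (r * real (Suc n)))) * 1"
      using le \<open>c \<ge> 0\<close> \<open>p > 0\<close> unfolding c_def[symmetric] p_def[symmetric]
      by (simp add: abs_mult mult_ac)
  qed
qed

section \<open>Inversion at points of continuity\<close>

text \<open>An integrable function continuous at \<open>a\<close> may be unbounded elsewhere, so dominated
  convergence after rescaling is applied only to its restriction \<open>h\<close> to a ball around \<open>a\<close> on
  which it is bounded. Away from that ball the kernel itself is uniformly small, and the
  remainder \<open>k\<close> needs only to be integrable.\<close>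
lemma gauss_approximate_identity:
  fixes f :: "'a::euclidean_space \<Rightarrow> complex"
  assumes f: "integrable lborel f" and cont: "isCont f a"
  shows "(\<lambda>n. LINT t|lborel. f t * complex_of_real (gauss_kernel (real (Suc n)) (t - a))) \<longlonglongrightarrow> f a"
proof -
  have [measurable]: "f \<in> borel_measurable borel"
    using f by auto
  obtain r where r: "r > 0" and near: "\<And>t. dist t a < r \<Longrightarrow> dist (f t) (f a) < 1"
    using cont unfolding continuous_at_eps_delta by (metis zero_less_one)
  define h where "h t = indicator (ball a r) t *\<^sub>R f t" for t
  define k where "k t = indicator (- ball a r) t *\<^sub>R f t" for t
  have [measurable]: "h \<in> borel_measurable borel" "k \<in> borel_measurable borel"
    unfolding h_def k_def by (auto intro!: borel_measurable_scaleR borel_measurable_indicator)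
  have split: "f t = h t + k t" for t
    by (simp add: h_def k_def indicator_def)
  have h_bound: "norm (h t) \<le> norm (f a) + 1" for t
  proof (cases "t \<in> ball a r")
    case True
    then have "dist (f t) (f a) < 1"
      by (intro near) (simp add: dist_commute)
    then show ?thesis
      using True norm_triangle_sub[of "f t" "f a"] by (simp add: h_def dist_norm)
  qed (simp add: h_def add_nonneg_nonneg)
  have h_cont: "isCont h a"
  proof -
    have "eventually (\<lambda>t. t \<in> ball a r) (nhds a)"
      using r by (intro eventually_nhds_in_open) auto
    then have "eventually (\<lambda>t. h t = f t) (nhds a)"
      by eventually_elim (simp add: h_def)
    then show ?thesis
      using cont isCont_cong by blast
  qed
  have K_int: "integrable lborel (\<lambda>t. gauss_kernel s (t - a))" if "s > 0" for s
    using has_bochner_integral_gauss_kernel[OF that, of a] by (simp add: has_bochner_integral_iff)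
  have h_int: "integrable lborel (\<lambda>t. h t * complex_of_real (gauss_kernel s (t - a)))" if "s > 0" for s
  proof (rule Bochner_Integration.integrable_bound)
    show "integrable lborel (\<lambda>t. (norm (f a) + 1) * gauss_kernel s (t - a))"
      using K_int[OF that] by simp
    show "AE t in lborel. norm (h t * complex_of_real (gauss_kernel s (t - a)))
        \<le> norm ((norm (f a) + 1) * gauss_kernel s (t - a))"
      using h_bound by (intro AE_I2) (auto simp: norm_mult abs_mult intro!: mult_right_mono order_trans[OF h_bound])
  qed measurable
  have near_lim: "(\<lambda>n. LINT t|lborel. h t * complex_of_real (gauss_kernel (real (Suc n)) (t - a))) \<longlonglongrightarrow> f a"
  proof -
    have rescale: "(LINT t|lborel. h t * complex_of_real (gauss_kernel s (t - a)))
        = (LINT z|lborel. h (a + z /\<^sub>R s) * complex_of_real (gauss_kernel 1 z))" if s: "s > 0" for s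
    proof -
      have "has_bochner_integral lborel (\<lambda>z. h (a + z /\<^sub>R s) * complex_of_real (gauss_kernel s (a + z /\<^sub>R s - a)))
         ((LINT t|lborel. h t * complex_of_real (gauss_kernel s (t - a))) /\<^sub>R \<bar>inverse s\<bar> ^ DIM('a))"
        using h_int[OF s] s by (intro has_bochner_integral_lborel_affine has_bochner_integral_integrable) auto
      then have "(LINT z|lborel. h (a + z /\<^sub>R s) * complex_of_real (gauss_kernel s (a + z /\<^sub>R s - a)))
         = s ^ DIM('a) *\<^sub>R (LINT t|lborel. h t * complex_of_real (gauss_kernel s (t - a)))"
        using s by (simp add: has_bochner_integral_iff power_inverse)
      moreover have "h (a + z /\<^sub>R s) * complex_of_real (gauss_kernel s (a + z /\<^sub>R s - a))
         = s ^ DIM('a) *\<^sub>R (h (a + z /\<^sub>R s) * complex_of_real (gauss_kernel 1 z))" for z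
        using gauss_kernel_rescale[OF s, of z] by (simp add: scaleR_conv_of_real)
      ultimately show ?thesis
        using s by simp
    qed
    have "(\<lambda>n. LINT z|lborel. h (a + z /\<^sub>R real (Suc n)) * complex_of_real (gauss_kernel 1 z))
        \<longlonglongrightarrow> (LINT z|lborel. h a * complex_of_real (gauss_kernel 1 (z::'a)))"
    proof (rule integral_dominated_convergence[where w="\<lambda>z. (norm (f a) + 1) * gauss_kernel 1 z"])
      show "integrable lborel (\<lambda>z::'a. (norm (f a) + 1) * gauss_kernel 1 z)"
        using has_bochner_integral_gauss_kernel[of 1 "0::'a"] by (simp add: has_bochner_integral_iff)
      show "AE z in lborel. norm (h (a + z /\<^sub>R real (Suc n)) * complex_of_real (gauss_kernel 1 z))
          \<le> (norm (f a) + 1) * gauss_kernel 1 z" for n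
        using h_bound by (intro AE_I2) (auto simp: norm_mult gauss_kernel_nonneg intro!: mult_right_mono)
      have "(\<lambda>n. a + z /\<^sub>R real (Suc n)) \<longlonglongrightarrow> a + 0 *\<^sub>R z" for z :: 'a
        by (intro tendsto_intros LIMSEQ_inverse_real_of_nat)
      then have "(\<lambda>n. h (a + z /\<^sub>R real (Suc n))) \<longlonglongrightarrow> h a" for z :: 'a
        by (intro isCont_tendsto_compose[OF h_cont]) simp
      then show "AE z in lborel. (\<lambda>n. h (a + z /\<^sub>R real (Suc n)) * complex_of_real (gauss_kernel 1 z))
          \<longlonglongrightarrow> h a * complex_of_real (gauss_kernel 1 z)"
        by (intro AE_I2 tendsto_mult tendsto_const) auto
    qed measurable
    also have "(LINT z|lborel. h a * complex_of_real (gauss_kernel 1 (z::'a))) = h a"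
      using has_bochner_integral_gauss_kernel[of 1 "0::'a"] by (simp add: has_bochner_integral_iff)
    also have "h a = f a"
      using r by (simp add: h_def)
    finally show ?thesis
      by (simp add: rescale)
  qed
  have k_int: "integrable lborel k"
    unfolding k_def by (rule integrable_mult_indicator) (use f in auto)
  define B where "B n = (real (Suc n) / sqrt (2 * pi)) ^ DIM('a) * exp (- (real (Suc n) * r)\<^sup>2 / 2)" for n
  have k_bound: "norm (k t * complex_of_real (gauss_kernel (real (Suc n)) (t - a))) \<le> B n * norm (k t)" for n t
  proof (cases "t \<in> ball a r")
    case False
    then have "r \<le> norm (t - a)"
      by (simp add: dist_norm norm_minus_commute)
    then have "(real (Suc n) * r)\<^sup>2 \<le> (norm (real (Suc n) *\<^sub>R (t - a)))\<^sup>2"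
      using r unfolding norm_scaleR by (intro power_mono mult_mono) auto
    then have "gauss_kernel (real (Suc n)) (t - a) \<le> B n"
      unfolding gauss_kernel_def B_def by (intro mult_left_mono) auto
    then show ?thesis
      by (simp add: norm_mult gauss_kernel_nonneg mult.commute[of "norm (k t)"] mult_right_mono)
  qed (simp add: k_def)
  have k_int': "integrable lborel (\<lambda>t. k t * complex_of_real (gauss_kernel (real (Suc n)) (t - a)))" for n
  proof (rule Bochner_Integration.integrable_bound)
    show "integrable lborel (\<lambda>t. B n * norm (k t))"
      using k_int by simp
    show "AE t in lborel. norm (k t * complex_of_real (gauss_kernel (real (Suc n)) (t - a))) \<le> norm (B n * norm (k t))"
      by (intro AE_I2 order_trans[OF k_bound]) simp
  qed measurable
  have far_lim: "(\<lambda>n. LINT t|lborel. k t * complex_of_real (gauss_kernel (real (Suc n)) (t - a))) \<longlonglongrightarrow> 0"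
  proof (rule Lim_null_comparison)
    have "norm (LINT t|lborel. k t * complex_of_real (gauss_kernel (real (Suc n)) (t - a)))
        \<le> (LINT t|lborel. B n * norm (k t))" for n
      by (rule Bochner_Integration.integral_norm_bound_integral) (use k_int' k_int k_bound in auto)
    then show "\<forall>\<^sub>F n in sequentially. norm (LINT t|lborel. k t * complex_of_real (gauss_kernel (real (Suc n)) (t - a)))
        \<le> B n * (LINT t|lborel. norm (k t))"
      by simp
    show "(\<lambda>n. B n * (LINT t|lborel. norm (k t))) \<longlonglongrightarrow> 0"
      unfolding B_def using gauss_kernel_tail[OF r] by (intro tendsto_mult_left_zero)
  qed
  have "(LINT t|lborel. f t * complex_of_real (gauss_kernel (real (Suc n)) (t - a))) =
     (LINT t|lborel. h t * complex_of_real (gauss_kernel (real (Suc n)) (t - a))) +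
     (LINT t|lborel. k t * complex_of_real (gauss_kernel (real (Suc n)) (t - a)))" for n
    unfolding split distrib_right by (intro Bochner_Integration.integral_add h_int k_int') simp
  then show ?thesis
    using tendsto_add[OF near_lim far_lim] by simp
qed

lemma fourier_inversion_at_continuity_point:
  fixes f :: "'a::euclidean_space \<Rightarrow> complex"
  assumes f: "integrable lborel f" and Ff: "integrable lborel (borel_fourier f)" and cont: "isCont f x"
  shows "borel_fourier (borel_fourier f) (- x) = complex_of_real ((2 * pi) ^ DIM('a)) * f x"
proof (rule LIMSEQ_unique)
  let ?G = "\<lambda>n. LINT t|lborel. f t * complex_of_real (gauss_kernel (real (Suc n)) (t - x))"
  show "(\<lambda>n. complex_of_real ((2 * pi) ^ DIM('a)) * ?G n) \<longlonglongrightarrow> complex_of_real ((2 * pi) ^ DIM('a)) * f x"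
    by (intro tendsto_mult tendsto_const gauss_approximate_identity f cont)
  show "(\<lambda>n. complex_of_real ((2 * pi) ^ DIM('a)) * ?G n) \<longlonglongrightarrow> borel_fourier (borel_fourier f) (- x)"
    using fourier_gauss_limit[OF Ff, of "- x"]
    by (subst (asm) fourier_gauss_smoothing[OF f]) auto
qed

section \<open>Integrability of the double transform\<close>

text \<open>Almost everywhere inversion for \<open>g\<close> would identify the double transform with a
  reflected multiple of \<open>g\<close>, but integrability needs less: the Gaussian means of the double
  integral are, up to a reflection, convolutions of \<open>g\<close> with kernels of mass
  \<open>(2 \<pi>)^d\<close>. Their norms in \<open>L\<^sub>1\<close> are therefore uniformly bounded, and Fatou's lemma
  passes this bound to the pointwise limit.\<close>
lemma integrable_double_fourier:
  fixes g :: "'a::euclidean_space \<Rightarrow> complex"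
  assumes g: "integrable lborel g" and Fg: "integrable lborel (borel_fourier g)"
  shows "integrable lborel (borel_fourier (borel_fourier g))"
proof (rule integrableI_bounded)
  have [measurable]: "g \<in> borel_measurable borel"
    using g by auto
  show "borel_fourier (borel_fourier g) \<in> borel_measurable lborel"
    using Fg by simp
  define c where "c = (2 * pi) ^ DIM('a)"
  have c: "c \<ge> 0" by (simp add: c_def)
  define A where "A n x = complex_of_real c * (LINT t|lborel. g t * complex_of_real (gauss_kernel (real (Suc n)) (t + x)))"
    for n x
  have [measurable]: "A n \<in> borel_measurable borel" for n
    unfolding A_def by measurable
  have lim: "(\<lambda>n. A n x) \<longlonglongrightarrow> borel_fourier (borel_fourier g) x" for x
    using fourier_gauss_limit[OF Fg, of x]
    by (subst (asm) fourier_gauss_smoothing[OF g]) (auto simp: A_def c_def)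
  have bound: "(\<integral>\<^sup>+x. ennreal (norm (A n x)) \<partial>lborel) \<le> ennreal c * (\<integral>\<^sup>+t. ennreal (norm (g t)) \<partial>lborel)" for n
  proof -
    let ?K = "gauss_kernel (real (Suc n)) :: 'a \<Rightarrow> real"
    have mass: "(\<integral>\<^sup>+x. ennreal (?K (t + x)) \<partial>lborel) = 1" for t
      using has_bochner_integral_gauss_kernel[of "real (Suc n)" "- t"]
      by (simp add: has_bochner_integral_iff nn_integral_eq_integral gauss_kernel_nonneg add.commute)
    have "ennreal (norm (A n x)) \<le> ennreal c * (\<integral>\<^sup>+t. ennreal (norm (g t)) * ennreal (?K (t + x)) \<partial>lborel)" for x
    proof -
      have "ennreal (norm (A n x)) = ennreal c * ennreal (norm (LINT t|lborel. g t * complex_of_real (?K (t + x))))"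
        using c by (simp add: A_def norm_mult ennreal_mult)
      also have "\<dots> \<le> ennreal c * (\<integral>\<^sup>+t. ennreal (norm (g t * complex_of_real (?K (t + x)))) \<partial>lborel)"
      proof (intro mult_left_mono)
        show "ennreal (norm (LINT t|lborel. g t * complex_of_real (?K (t + x))))
            \<le> (\<integral>\<^sup>+t. ennreal (norm (g t * complex_of_real (?K (t + x)))) \<partial>lborel)"
          by (cases "integrable lborel (\<lambda>t. g t * complex_of_real (?K (t + x)))")
            (auto simp: not_integrable_integral_eq intro: integral_norm_bound_ennreal)
      qed simp
      finally show ?thesis
        by (simp add: norm_mult ennreal_mult gauss_kernel_nonneg)
    qed
    then have "(\<integral>\<^sup>+x. ennreal (norm (A n x)) \<partial>lborel)
      \<le> (\<integral>\<^sup>+x. ennreal c * (\<integral>\<^sup>+t. ennreal (norm (g t)) * ennreal (?K (t + x)) \<partial>lborel) \<partial>lborel)"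
      by (intro nn_integral_mono)
    also have "\<dots> = ennreal c * (\<integral>\<^sup>+x. (\<integral>\<^sup>+t. ennreal (norm (g t)) * ennreal (?K (t + x)) \<partial>lborel) \<partial>lborel)"
      by (rule nn_integral_cmult) measurable
    also have "(\<integral>\<^sup>+x. (\<integral>\<^sup>+t. ennreal (norm (g t)) * ennreal (?K (t + x)) \<partial>lborel) \<partial>lborel)
       = (\<integral>\<^sup>+t. (\<integral>\<^sup>+x. ennreal (norm (g t)) * ennreal (?K (t + x)) \<partial>lborel) \<partial>lborel)"
      by (rule lborel_pair.Fubini') measurable
    also have "\<dots> = (\<integral>\<^sup>+t. ennreal (norm (g t)) \<partial>lborel)"
      by (simp add: nn_integral_cmult mass del: of_nat_Suc)
    finally show ?thesis .
  qed
  have "(\<integral>\<^sup>+x. ennreal (norm (borel_fourier (borel_fourier g) x)) \<partial>lborel)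
      = (\<integral>\<^sup>+x. liminf (\<lambda>n. ennreal (norm (A n x))) \<partial>lborel)"
    using lim by (intro nn_integral_cong lim_imp_Liminf[symmetric] tendsto_ennrealI tendsto_norm) auto
  also have "\<dots> \<le> liminf (\<lambda>n. \<integral>\<^sup>+x. ennreal (norm (A n x)) \<partial>lborel)"
    by (rule nn_integral_liminf) measurable
  also have "\<dots> \<le> liminf (\<lambda>n. ennreal c * (\<integral>\<^sup>+t. ennreal (norm (g t)) \<partial>lborel))"
    by (intro Liminf_mono always_eventually allI bound)
  also have "\<dots> = ennreal c * (\<integral>\<^sup>+t. ennreal (norm (g t)) \<partial>lborel)"
    by (simp add: Liminf_const)
  also have "\<dots> < \<infinity>"
    using g by (auto simp: integrable_iff_bounded ennreal_mult_less_top)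
  finally show "(\<integral>\<^sup>+x. ennreal (norm (borel_fourier (borel_fourier g) x)) \<partial>lborel) < \<infinity>" .
qed

section \<open>Functions with integrable Fourier transform\<close>

lemma lebesgue_integrable_borel_version:
  fixes g :: "'a::euclidean_space \<Rightarrow> complex"
  assumes g: "integrable lebesgue g"
  obtains g' where "integrable lborel g'" "AE x in lebesgue. g x = g' x"
proof -
  have [measurable]: "g \<in> borel_measurable lebesgue"
    using g by auto
  obtain u where u: "u \<in> borel_measurable lborel" "AE x in lborel. Re (g x) = u x"
    using completion_ex_borel_measurable_real[of "\<lambda>x. Re (g x)" lborel] by auto
  obtain v where v: "v \<in> borel_measurable lborel" "AE x in lborel. Im (g x) = v x"
    using completion_ex_borel_measurable_real[of "\<lambda>x. Im (g x)" lborel] by auto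
  define g' where "g' x = Complex (u x) (v x)" for x
  have [measurable]: "g' \<in> borel_measurable lborel"
    using u(1) v(1) unfolding g'_def Complex_eq by measurable
  have "AE x in lborel. g x = g' x"
    using u(2) v(2) by eventually_elim (simp add: g'_def complex_eq_iff)
  then have ae: "AE x in lebesgue. g x = g' x"
    by (rule AE_completion)
  have "g' \<in> borel_measurable lebesgue"
    by (rule measurable_completion) simp
  then have "integrable lebesgue g'"
    using g ae integrable_cong_AE[of g lebesgue g'] by simp
  then have "integrable lborel g'"
    by (simp add: integrable_completion)
  then show thesis
    using ae that by blast
qed

lemma fourier_integral_lborel:
  fixes g :: "'a::euclidean_space \<Rightarrow> complex"
  assumes "g \<in> borel_measurable borel"
  shows "(LINT x|lebesgue. g x * exp (- (\<i> * complex_of_real (x \<bullet> y)))) = borel_fourier g y"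
proof -
  note [measurable] = assms
  have "(\<lambda>x. g x * exp (- (\<i> * complex_of_real (x \<bullet> y)))) \<in> borel_measurable lborel"
    by simp
  then show ?thesis
    unfolding borel_fourier_def by (rule integral_completion)
qed

theorem mainTheorem1:
  fixes f :: "real ^ 'n \<Rightarrow> complex"
  assumes "integrable lebesgue f"
  shows "f \<in> wiener_algebra \<longleftrightarrow>
         continuous_on UNIV f \<and> integrable lebesgue (fourier_transform f)"
proof
  assume "f \<in> wiener_algebra"
  then obtain g where g: "integrable lebesgue g"
    and fg: "\<And>x. f x = (LINT y|lebesgue. g y * exp (- (\<i> * complex_of_real (x \<bullet> y))))"
    by (auto simp: wiener_algebra_def)
  obtain g' where g': "integrable lborel g'" and ae: "AE x in lebesgue. g x = g' x"
    using lebesgue_integrable_borel_version[OF g] .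
  have [measurable]: "g \<in> borel_measurable lebesgue" "g' \<in> borel_measurable borel"
    using g g' by auto
  have [measurable]: "g' \<in> borel_measurable lebesgue"
    by (rule measurable_completion) simp
  have f_eq: "f = borel_fourier g'"
  proof
    fix x :: "real ^ 'n"
    have [measurable]: "(\<lambda>y :: real ^ 'n. exp (- (\<i> * complex_of_real (y \<bullet> x)))) \<in> borel_measurable lebesgue"
      by (rule measurable_completion) simp
    have "f x = (LINT y|lebesgue. g y * exp (- (\<i> * complex_of_real (y \<bullet> x))))"
      by (simp add: fg inner_commute)
    also have "\<dots> = (LINT y|lebesgue. g' y * exp (- (\<i> * complex_of_real (y \<bullet> x))))"
    proof (rule integral_cong_AE)
      show "AE y in lebesgue. g y * exp (- (\<i> * complex_of_real (y \<bullet> x))) =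
          g' y * exp (- (\<i> * complex_of_real (y \<bullet> x)))"
        using ae by eventually_elim simp
    qed simp_all
    also have "\<dots> = borel_fourier g' x"
      by (rule fourier_integral_lborel) measurable
    finally show "f x = borel_fourier g' x" .
  qed
  have cont: "continuous_on UNIV f"
    unfolding f_eq by (rule continuous_borel_fourier[OF g'])
  then have f_borel: "f \<in> borel_measurable borel"
    by (rule borel_measurable_continuous_onI)
  then have f_int: "integrable lborel f"
    using assms by (simp add: integrable_completion)
  have "fourier_transform f = borel_fourier f"
    using fourier_integral_lborel[OF f_borel] by (auto simp: fourier_transform_def)
  moreover have "integrable lborel (borel_fourier f)"
    using integrable_double_fourier[OF g'] f_int unfolding f_eq by simp
  ultimately show "continuous_on UNIV f \<and> integrable lebesgue (fourier_transform f)"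
    using cont f_int by (simp add: integrable_completion)
next
  assume "continuous_on UNIV f \<and> integrable lebesgue (fourier_transform f)"
  then have cont: "continuous_on UNIV f" and Ff: "integrable lebesgue (fourier_transform f)"
    by auto
  have f_borel: "f \<in> borel_measurable borel"
    using cont by (rule borel_measurable_continuous_onI)
  then have f_int: "integrable lborel f"
    using assms by (simp add: integrable_completion)
  have "fourier_transform f = borel_fourier f"
    using fourier_integral_lborel[OF f_borel] by (auto simp: fourier_transform_def)
  then have Ff_int: "integrable lborel (borel_fourier f)"
    using Ff f_int by (simp add: integrable_completion)
  define c where "c = complex_of_real ((2 * pi) ^ DIM(real ^ 'n))"
  have c: "c \<noteq> 0"
    by (simp add: c_def)
  \<comment> \<open>Inversion gives the values of f at x from the double transform at -x; the reflection
      in g moves this sign from x to the integration variable.\<close>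
  define g where "g y = inverse c * borel_fourier f (- y)" for y
  have refl: "has_bochner_integral lborel (\<lambda>y. h (- y)) (integral\<^sup>L lborel h)"
    if "integrable lborel h" for h :: "real ^ 'n \<Rightarrow> complex"
    using has_bochner_integral_lborel_affine[OF has_bochner_integral_integrable[OF that], of "- 1" 0] by simp
  have g_int: "integrable lborel g"
    unfolding g_def using refl[OF Ff_int] by (simp add: has_bochner_integral_iff)
  have "f x = borel_fourier g x" for x
  proof -
    have [measurable]: "borel_fourier f \<in> borel_measurable borel"
      using f_int by simp
    have "integrable lborel (\<lambda>y. borel_fourier f y * exp (- (\<i> * complex_of_real (y \<bullet> - x))))"
      by (rule Bochner_Integration.integrable_bound[OF Ff_int]) (auto simp: norm_mult)
    from refl[OF this] have "(LINT y|lborel. borel_fourier f (- y) * exp (- (\<i> * complex_of_real (y \<bullet> x))))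
        = borel_fourier (borel_fourier f) (- x)"
      by (simp add: has_bochner_integral_iff borel_fourier_def[of "borel_fourier f"])
    also have "\<dots> = c * f x"
      using cont unfolding c_def
      by (intro fourier_inversion_at_continuity_point f_int Ff_int) (simp add: continuous_on_eq_continuous_at)
    finally show ?thesis
      using c by (simp add: borel_fourier_def[of g] g_def mult.assoc)
  qed
  moreover have "(LINT y|lebesgue. g y * exp (- (\<i> * complex_of_real (x \<bullet> y)))) = borel_fourier g x" for x
    using fourier_integral_lborel[of g x] g_int by (simp add: inner_commute)
  moreover have "integrable lebesgue g"
    using g_int by (simp add: integrable_completion)
  ultimately show "f \<in> wiener_algebra"
    unfolding wiener_algebra_def by auto
qed

end
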